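(* Let $k\ge 1$ be any integer. Then MPGNNs with H-$k$-LAPE are strictly more expressive than the 1-WL test, and hence strictly more expressive than MPGNNs without encodings. That is: (i) every pair of graphs distinguished by the 1-WL test (respectively, by MPGNNs without encodings) is distinguished by MPGNNs with H-$k$-LAPE; and (ii) there exists a pair of graphs that is not distinguished by the 1-WL test (respectively, by MPGNNs without encodings) but is distinguished by MPGNNs with H-$k$-LAPE. Furthermore, there exist two graphs that can be distinguished using H-$k$-LAPE but cannot be distinguished using $k$-LAPE.
   Context: Graphs are finite, simple, undirected, and carry no node attributes (equivalently, constant node attributes). Lifting. The lift of a graph $G=(V,E)$ is the hypergraph $H(G)$ on the vertex set $V$ whose hyperedges are the maximal cliques of $G$ with at least two vertices. $k$-LAPE (graph level). Let $\Delta=D-A$ be the graph Laplacian of $G$ ($D$ the diagonal degree matrix, $A$ the adjacency matrix). Choose orthonormal eigenvectors $u_1,\dots,u_{n}\in\mathbb{R}^V$ ($n=|V|$) of $\Delta$ ordered by non-increasing eigenvalue ("top" eigenvectors first). The $k$-LAPE of a node $i$ is $(u_1(i),\dots,u_k(i))\in\mathbb{R}^k$; if $n<k$, the missing entries are set to $0$. H-$k$-LAPE (hypergraph level). Let $B_1\in\{0,1\}^{V\times F}$ be the unsigned incidence matrix of $H(G)$, where $F$ is the set of hyperedges: $(B_1)_{i,e}=1$ if $i\in e$ and $0$ otherwise. The Hodge Laplacian acting on node functions is $B_1B_1^T\in\mathbb{R}^{V\times V}$. H-$k$-LAPE is defined in the same way as $k$-LAPE, with $\Delta$ replaced by $B_1B_1^T$.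 An admissible choice for a graph $G=(V,E)$ with $n=|V|$ is any choice of orthonormal eigenvectors $u_1,\dots,u_n\in\mathbb{R}^V$, ordered by non-increasing eigenvalue, of the matrix $\Delta$ (in the case of $k$-LAPE) or of the matrix $B_1B_1^T$ (in the case of H-$k$-LAPE) (in particular, signs are arbitrary). Distinguishing using an encoding. Two graphs $G,G'$ can be distinguished using $k$-LAPE (respectively H-$k$-LAPE) if for all admissible choices of eigenvectors for $G$ and $G'$, the multisets of node encodings of $G$ and of $G'$ are different (i.e. the encoding matrices differ up to row permutation). They cannot be distinguished if for some admissible choices these multisets coincide. MPGNNs. An MPGNN with $L\ge 0$ layers starts from initial node representations $x_v^0$ and computes $x_v^{l+1}=\varphi_l\big(x_v^l,\{\!\{x_u^l: u\in\mathcal N_v\}\!\}\big)$ for $0\le l<L$, where $\mathcal N_v$ is the set of neighbors of $v$ in $G$, $\{\!\{\cdot\}\!\}$ denotes a multiset, and the $\varphi_l$ are arbitrary functions, the same for all nodes and all graphs. Without encodings, $x_v^0$ is a constant; with an encoding, $x_v^0$ is the encoding of $v$. MPGNNs without encodings distinguish $G,G'$ if some MPGNN produces different multisets of final node representations $\{\!\{x_v^L\}\!\}$ on $G$ and $G'$. MPGNNs with H-$k$-LAPE distinguish $G,G'$ if for all admissible choices of eigenvectors for $G$ and $G'$ there is an MPGNN producing different multisets of final node representations. Message passing takes place on the graph $G$. 1-WL test. All nodes start with the same color; at each round the new color of $v$ is an injective function of its current color and the multiset of the current colors of its neighbors. The test distinguishes $G,G'$ if at some round the multisets of node colors of $G$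 and $G'$ differ. *)

theory Defs
  imports Complex_Main "HOL-Library.Multiset" "Graph_Theory.Pair_Digraph"
begin

text \<open>
  A finite simple undirected graph is a \<open>pair_graph\<close>: an edge \<open>{u, v}\<close> is represented by the two
  arcs \<open>(u, v)\<close> and \<open>(v, u)\<close>. Vectors and matrices indexed by the vertices are functions of which
  only the values on the vertex set matter.
\<close>

definition neighbours :: "'a pair_pre_digraph \<Rightarrow> 'a \<Rightarrow> 'a set" where
  "neighbours G v = {u \<in> pverts G. (v, u) \<in> parcs G}"

definition node_multiset :: "'a pair_pre_digraph \<Rightarrow> ('a \<Rightarrow> 'c) \<Rightarrow> 'c multiset" where
  "node_multiset G x = image_mset x (mset_set (pverts G))"

definition neighbour_multiset :: "'a pair_pre_digraph \<Rightarrow> ('a \<Rightarrow> 'c) \<Rightarrow> 'a \<Rightarrow> 'c multiset" where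
  "neighbour_multiset G x v = image_mset x (mset_set (neighbours G v))"

definition is_clique :: "'a pair_pre_digraph \<Rightarrow> 'a set \<Rightarrow> bool" where
  "is_clique G C \<longleftrightarrow> C \<subseteq> pverts G \<and> (\<forall>u\<in>C. \<forall>v\<in>C. u \<noteq> v \<longrightarrow> (u, v) \<in> parcs G)"

definition maximal_clique :: "'a pair_pre_digraph \<Rightarrow> 'a set \<Rightarrow> bool" where
  "maximal_clique G C \<longleftrightarrow> is_clique G C \<and> (\<forall>C'. is_clique G C' \<and> C \<subseteq> C' \<longrightarrow> C' = C)"

definition hyperedges :: "'a pair_pre_digraph \<Rightarrow> 'a set set" where
  "hyperedges G = {C. maximal_clique G C \<and> 2 \<le> card C}"

definition degree_matrix :: "'a pair_pre_digraph \<Rightarrow> 'a \<Rightarrow> 'a \<Rightarrow> real" where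
  "degree_matrix G i j = (if i = j then real (card (neighbours G i)) else 0)"

definition adjacency_matrix :: "'a pair_pre_digraph \<Rightarrow> 'a \<Rightarrow> 'a \<Rightarrow> real" where
  "adjacency_matrix G i j = (if (i, j) \<in> parcs G then 1 else 0)"

definition graph_laplacian :: "'a pair_pre_digraph \<Rightarrow> 'a \<Rightarrow> 'a \<Rightarrow> real" where
  "graph_laplacian G i j = degree_matrix G i j - adjacency_matrix G i j"

definition incidence_matrix :: "'a \<Rightarrow> 'a set \<Rightarrow> real" where
  "incidence_matrix i e = (if i \<in> e then 1 else 0)"

text \<open>The entries of \<open>B\<^sub>1 B\<^sub>1\<^sup>T\<close>.\<close>

definition hodge_laplacian :: "'a pair_pre_digraph \<Rightarrow> 'a \<Rightarrow> 'a \<Rightarrow> real" where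
  "hodge_laplacian G i j = (\<Sum>e\<in>hyperedges G. incidence_matrix i e * incidence_matrix j e)"

text \<open>
  Eigenvectors are numbered from 0 instead of 1, i.e. \<open>u 0, \<dots>, u (n - 1)\<close> with \<open>n = card V\<close>.
  They are nonzero because they are normalised.
\<close>

definition admissible :: "'a set \<Rightarrow> ('a \<Rightarrow> 'a \<Rightarrow> real) \<Rightarrow> (nat \<Rightarrow> 'a \<Rightarrow> real) \<Rightarrow> bool" where
  "admissible V M u \<longleftrightarrow>
     (\<forall>a < card V. \<forall>b < card V. (\<Sum>i\<in>V. u a i * u b i) = (if a = b then 1 else 0)) \<and>
     (\<exists>lam :: nat \<Rightarrow> real.
        (\<forall>a < card V. \<forall>i\<in>V. (\<Sum>j\<in>V. M i j * u a j) = lam a * u a i) \<and>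
        (\<forall>a b. a \<le> b \<and> b < card V \<longrightarrow> lam b \<le> lam a))"

definition node_encoding :: "nat \<Rightarrow> 'a set \<Rightarrow> (nat \<Rightarrow> 'a \<Rightarrow> real) \<Rightarrow> 'a \<Rightarrow> real list" where
  "node_encoding k V u i = map (\<lambda>a. if a < card V then u a i else 0) [0..<k]"

definition distinguished_by_LAPE ::
    "nat \<Rightarrow> 'a pair_pre_digraph \<Rightarrow> 'b pair_pre_digraph \<Rightarrow> bool" where
  "distinguished_by_LAPE k G G' \<longleftrightarrow>
     (\<forall>u u'. admissible (pverts G) (graph_laplacian G) u \<longrightarrow>
             admissible (pverts G') (graph_laplacian G') u' \<longrightarrow>
             node_multiset G (node_encoding k (pverts G) u) \<noteq>
             node_multiset G' (node_encoding k (pverts G') u'))"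

definition distinguished_by_HLAPE ::
    "nat \<Rightarrow> 'a pair_pre_digraph \<Rightarrow> 'b pair_pre_digraph \<Rightarrow> bool" where
  "distinguished_by_HLAPE k G G' \<longleftrightarrow>
     (\<forall>u u'. admissible (pverts G) (hodge_laplacian G) u \<longrightarrow>
             admissible (pverts G') (hodge_laplacian G') u' \<longrightarrow>
             node_multiset G (node_encoding k (pverts G) u) \<noteq>
             node_multiset G' (node_encoding k (pverts G') u'))"

text \<open>
  Node representations are real vectors of arbitrary dimension, which may change from layer to
  layer. Update functions into an arbitrary set are no more general: starting from such vectors,
  the representations that can arise form a set of at most the cardinality of the continuum, and
  such a set embeds into the type \<open>real list\<close>.
\<close>

primrec mpgnn ::
    "(nat \<Rightarrow> real list \<Rightarrow> real list multiset \<Rightarrow> real list) \<Rightarrow> 'a pair_pre_digraph \<Rightarrow>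
     ('a \<Rightarrow> real list) \<Rightarrow> nat \<Rightarrow> 'a \<Rightarrow> real list" where
  "mpgnn \<phi> G x 0 v = x v"
| "mpgnn \<phi> G x (Suc l) v = \<phi> l (mpgnn \<phi> G x l v) (neighbour_multiset G (mpgnn \<phi> G x l) v)"

definition distinguished_by_MPGNN :: "'a pair_pre_digraph \<Rightarrow> 'b pair_pre_digraph \<Rightarrow> bool" where
  "distinguished_by_MPGNN G G' \<longleftrightarrow>
     (\<exists>L \<phi> c. node_multiset G (mpgnn \<phi> G (\<lambda>_. c) L) \<noteq> node_multiset G' (mpgnn \<phi> G' (\<lambda>_. c) L))"

definition distinguished_by_MPGNN_HLAPE ::
    "nat \<Rightarrow> 'a pair_pre_digraph \<Rightarrow> 'b pair_pre_digraph \<Rightarrow> bool" where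
  "distinguished_by_MPGNN_HLAPE k G G' \<longleftrightarrow>
     (\<forall>u u'. admissible (pverts G) (hodge_laplacian G) u \<longrightarrow>
             admissible (pverts G') (hodge_laplacian G') u' \<longrightarrow>
             (\<exists>L \<phi>. node_multiset G (mpgnn \<phi> G (node_encoding k (pverts G) u) L) \<noteq>
                    node_multiset G' (mpgnn \<phi> G' (node_encoding k (pverts G') u') L)))"

text \<open>The free constructor \<open>Refine\<close> is the injective function that produces the new colour.\<close>

datatype wl_colour = Initial | Refine wl_colour "wl_colour multiset"

primrec wl :: "'a pair_pre_digraph \<Rightarrow> nat \<Rightarrow> 'a \<Rightarrow> wl_colour" where
  "wl G 0 v = Initial"
| "wl G (Suc t) v = Refine (wl G t v) (neighbour_multiset G (wl G t) v)"

definition distinguished_by_WL :: "'a pair_pre_digraph \<Rightarrow> 'b pair_pre_digraph \<Rightarrow> bool" where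
  "distinguished_by_WL G G' \<longleftrightarrow> (\<exists>t. node_multiset G (wl G t) \<noteq> node_multiset G' (wl G' t))"

end

(* A first layer that ignores its input makes any encoding at least as good as none, and a message
   passing network can carry out colour refinement. The 7-cycle and the disjoint union of a triangle
   and a 4-cycle are both 2-regular on 7 vertices, so message passing without encodings sees no
   difference. If the Hodge Laplacian of a connected graph has constant row sums, its top eigenspace
   is spanned by the constant vector; if the row sums are not constant, the constant vector is not an
   eigenvector at all. The first case applies to the 7-cycle (row sums 4) and to the complete graph
   K3 (row sums 3), the second to C3 + C4 (row sums 3 and 4) and to the path P3 (row sums 2, 4, 2),
   so the first coordinate of H-k-LAPE already separates both pairs. The graph Laplacian of K3 is a
   multiple of the identity on the complement of the constants, hence an eigenbasis of P3 is an
   admissible choice for K3 too, and k-LAPE does not separate them. *)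

theory Submission
  imports Defs "Jordan_Normal_Form.Determinant"
begin

section \<open>Message passing and colour refinement\<close>

definition regular :: "'a pair_pre_digraph \<Rightarrow> nat \<Rightarrow> bool" where
  "regular G d \<longleftrightarrow> (\<forall>v\<in>pverts G. card (neighbours G v) = d)"

lemma neighbour_multiset_cong:
  assumes "\<And>u. u \<in> pverts G \<Longrightarrow> x u = y u"
  shows "neighbour_multiset G x v = neighbour_multiset G y v"
  unfolding neighbour_multiset_def
proof (rule image_mset_cong)
  fix u assume "u \<in># mset_set (neighbours G v)"
  \<comment> \<open>\<open>mset_set\<close> of an infinite set is empty, so membership here implies
    membership in the set in either case.\<close>
  then have "u \<in> neighbours G v"
    by (metis elem_mset_set empty_iff mset_set.infinite set_mset_empty)
  then show "x u = y u" using assms by (simp add: neighbours_def)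
qed

lemma image_neighbour_multiset:
  "image_mset f (neighbour_multiset G x v) = neighbour_multiset G (\<lambda>u. f (x u)) v"
  by (simp add: neighbour_multiset_def multiset.map_comp comp_def)

lemma image_node_multiset:
  "image_mset f (node_multiset G x) = node_multiset G (\<lambda>u. f (x u))"
  by (simp add: node_multiset_def multiset.map_comp comp_def)

lemma node_multiset_cong:
  assumes "\<And>u. u \<in> pverts G \<Longrightarrow> x u = y u"
  shows "node_multiset G x = node_multiset G y"
  unfolding node_multiset_def
  by (rule image_mset_cong)
    (metis assms elem_mset_set empty_iff mset_set.infinite set_mset_empty)

text \<open>Each layer decodes the representations, performs one refinement and encodes the result.
  Only colours of rounds before \<open>t\<close> are ever decoded, so \<open>dec\<close> has to
  invert \<open>code\<close> on those alone.\<close>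

lemma mpgnn_simulates_wl:
  assumes code: "\<And>s v. s < t \<Longrightarrow> v \<in> pverts G \<Longrightarrow> dec (code (wl G s v)) = wl G s v"
    and v: "v \<in> pverts G"
  shows "mpgnn (\<lambda>_ x m. code (Refine (dec x) (image_mset dec m))) G (\<lambda>_. code Initial) t v
    = code (wl G t v)"
  using assms
proof (induction t arbitrary: v)
  case 0
  then show ?case by simp
next
  case (Suc t)
  let ?\<phi> = "\<lambda>_ x m. code (Refine (dec x) (image_mset dec m))"
  have IH: "mpgnn ?\<phi> G (\<lambda>_. code Initial) t u = code (wl G t u)" if "u \<in> pverts G" for u
    using Suc that by simp
  have "neighbour_multiset G (\<lambda>u. dec (mpgnn ?\<phi> G (\<lambda>_. code Initial) t u)) v
      = neighbour_multiset G (wl G t) v"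
    by (rule neighbour_multiset_cong) (simp add: IH Suc.prems(1))
  then show ?case
    using Suc.prems by (simp add: IH image_neighbour_multiset)
qed

lemma distinguished_by_WL_imp_MPGNN:
  assumes "pair_graph G" "pair_graph G'" "distinguished_by_WL G G'"
  shows "distinguished_by_MPGNN G G'"
proof -
  interpret G: pair_graph G by fact
  interpret G': pair_graph G' by fact
  from assms(3) obtain t where t: "node_multiset G (wl G t) \<noteq> node_multiset G' (wl G' t)"
    by (auto simp: distinguished_by_WL_def)
  \<comment> \<open>Only finitely many colours occur, so they can be coded by numbers.\<close>
  define S where "S = (\<Union>s\<le>t. wl G s ` pverts G \<union> wl G' s ` pverts G')"
  have "finite S" by (simp add: S_def)
  from finite_imp_inj_to_nat_seg[OF this] obtain f :: "wl_colour \<Rightarrow> nat" where f: "inj_on f S"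
    by auto
  define code where "code c = [real (f c)]" for c
  have inj: "inj_on code S"
    using f by (auto simp: inj_on_def code_def)
  define dec where "dec = inv_into S code"
  have dec: "dec (code c) = c" if "c \<in> S" for c
    using inj that by (simp add: dec_def)
  let ?\<phi> = "\<lambda>_ x m. code (Refine (dec x) (image_mset dec m))"
  have eq: "mpgnn ?\<phi> G (\<lambda>_. code Initial) t v = code (wl G t v)" if "v \<in> pverts G" for v
    by (rule mpgnn_simulates_wl[OF _ that]) (rule dec, auto simp: S_def)
  have eq': "mpgnn ?\<phi> G' (\<lambda>_. code Initial) t v = code (wl G' t v)" if "v \<in> pverts G'" for v
    by (rule mpgnn_simulates_wl[OF _ that]) (rule dec, auto simp: S_def)
  have "node_multiset G (mpgnn ?\<phi> G (\<lambda>_. code Initial) t)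
      \<noteq> node_multiset G' (mpgnn ?\<phi> G' (\<lambda>_. code Initial) t)"
  \<comment> \<open>Applying \<open>dec\<close> to equal final multisets would give equal colour
    multisets in round \<open>t\<close>. This is why \<open>S\<close> also contains the colours of
    the last round.\<close>
  proof
    assume "node_multiset G (mpgnn ?\<phi> G (\<lambda>_. code Initial) t)
      = node_multiset G' (mpgnn ?\<phi> G' (\<lambda>_. code Initial) t)"
    then have "node_multiset G (\<lambda>v. dec (mpgnn ?\<phi> G (\<lambda>_. code Initial) t v))
      = node_multiset G' (\<lambda>v. dec (mpgnn ?\<phi> G' (\<lambda>_. code Initial) t v))"
      by (simp flip: image_node_multiset)
    moreover have "node_multiset G (\<lambda>v. dec (mpgnn ?\<phi> G (\<lambda>_. code Initial) t v))
        = node_multiset G (wl G t)"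
      by (rule node_multiset_cong) (simp add: eq, rule dec, auto simp: S_def)
    moreover have "node_multiset G' (\<lambda>v. dec (mpgnn ?\<phi> G' (\<lambda>_. code Initial) t v))
        = node_multiset G' (wl G' t)"
      by (rule node_multiset_cong) (simp add: eq', rule dec, auto simp: S_def)
    ultimately show False using t by simp
  qed
  then show ?thesis unfolding distinguished_by_MPGNN_def by blast
qed

text \<open>Layer 0 overwrites the encoding \<open>x\<close> by \<open>c\<close>, and the remaining
  layers run \<open>\<phi>\<close> with its index shifted by one.\<close>

lemma mpgnn_constant_first_layer:
  "mpgnn (\<lambda>l. case l of 0 \<Rightarrow> \<lambda>_ _. c | Suc m \<Rightarrow> \<phi> m) G x (Suc l) = mpgnn \<phi> G (\<lambda>_. c) l"
proof (induction l)
  case 0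
  show ?case by (rule ext) simp
next
  case (Suc l)
  show ?case
    \<comment> \<open>Only the outermost layer is unfolded at first, so that the induction
      hypothesis, stated at \<open>Suc l\<close>, still matches.\<close>
    using Suc.IH by (intro ext) (simp add: mpgnn.simps(2)[of _ _ _ "Suc l"] del: mpgnn.simps(2),
      simp)
qed

lemma distinguished_by_MPGNN_imp_HLAPE:
  assumes "distinguished_by_MPGNN G G'"
  shows "distinguished_by_MPGNN_HLAPE k G G'"
  using assms unfolding distinguished_by_MPGNN_def distinguished_by_MPGNN_HLAPE_def
  by (metis mpgnn_constant_first_layer)

text \<open>A network with zero layers outputs the encoding itself.\<close>

lemma distinguished_by_HLAPE_imp_MPGNN_HLAPE:
  assumes "distinguished_by_HLAPE k G G'"
  shows "distinguished_by_MPGNN_HLAPE k G G'"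
proof -
  have "mpgnn \<phi> H x 0 = x" for \<phi> x and H :: "'c pair_pre_digraph"
    by (rule ext) simp
  moreover have "mpgnn \<phi> H x 0 = x" for \<phi> x and H :: "'d pair_pre_digraph"
    by (rule ext) simp
  ultimately show ?thesis
    using assms unfolding distinguished_by_HLAPE_def distinguished_by_MPGNN_HLAPE_def
    by (metis mpgnn.simps(1) ext)
qed

text \<open>By induction all nodes carry the same representation, so every node receives
  \<open>d\<close> copies of it. The resulting recursion depends on the graph only through
  \<open>d\<close>.\<close>

lemma mpgnn_regular:
  assumes "regular G d" "v \<in> pverts G"
  shows "mpgnn \<phi> G (\<lambda>_. c) l v = rec_nat c (\<lambda>m x. \<phi> m x (replicate_mset d x)) l"
  using assms(2)
proof (induction l arbitrary: v)
  case 0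
  show ?case by simp
next
  case (Suc l)
  let ?r = "rec_nat c (\<lambda>m x. \<phi> m x (replicate_mset d x))"
  have "neighbour_multiset G (mpgnn \<phi> G (\<lambda>_. c) l) v = neighbour_multiset G (\<lambda>_. ?r l) v"
    by (rule neighbour_multiset_cong) (rule Suc.IH)
  also have "\<dots> = replicate_mset d (?r l)"
    using assms(1) Suc.prems
    by (simp add: neighbour_multiset_def image_mset_const_eq regular_def)
  finally show ?case using Suc by simp
qed

lemma not_distinguished_by_MPGNN_regular:
  assumes "regular G d" "regular G' d"
    and "card (pverts G) = card (pverts G')"
  shows "\<not> distinguished_by_MPGNN G G'"
proof -
  have "node_multiset G (mpgnn \<phi> G (\<lambda>_. c) L) = node_multiset G' (mpgnn \<phi> G' (\<lambda>_. c) L)" for \<phi> c L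
  proof -
    let ?r = "rec_nat c (\<lambda>m x. \<phi> m x (replicate_mset d x)) L"
    have "node_multiset G (mpgnn \<phi> G (\<lambda>_. c) L) = node_multiset G (\<lambda>_. ?r)"
      by (rule node_multiset_cong) (rule mpgnn_regular[OF assms(1)])
    also have "\<dots> = node_multiset G' (\<lambda>_. ?r)"
      using assms(3) by (simp add: node_multiset_def image_mset_const_eq)
    also have "\<dots> = node_multiset G' (mpgnn \<phi> G' (\<lambda>_. c) L)"
      by (rule node_multiset_cong[symmetric]) (rule mpgnn_regular[OF assms(2)])
    finally show ?thesis .
  qed
  then show ?thesis by (simp add: distinguished_by_MPGNN_def)
qed

section \<open>Orthonormal eigenvectors and row sums\<close>

text \<open>A square matrix with orthonormal rows also has orthonormal columns, because a right
  inverse is a left inverse. An enumeration of \<open>V\<close> turns the family into such a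
  matrix.\<close>

lemma orthonormal_family_complete:
  fixes u :: "nat \<Rightarrow> 'a \<Rightarrow> real"
  assumes "finite V"
    and on: "\<And>a b. a < card V \<Longrightarrow> b < card V \<Longrightarrow> (\<Sum>i\<in>V. u a i * u b i) = (if a = b then 1 else 0)"
    and "i \<in> V" "j \<in> V"
  shows "(\<Sum>a<card V. u a i * u a j) = (if i = j then 1 else 0)"
proof -
  define n where "n = card V"
  obtain f where f: "bij_betw f {0..<n} V"
    using ex_bij_betw_nat_finite[OF assms(1)] n_def by blast
  define U where "U = mat n n (\<lambda>(a, p). u a (f p))"
  have U: "U \<in> carrier_mat n n" by (simp add: U_def)
  have "U * transpose_mat U = 1\<^sub>m n"
  proof (rule eq_matI)
    fix a b assume "a < dim_row (1\<^sub>m n :: real mat)" "b < dim_col (1\<^sub>m n :: real mat)"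
    then have ab: "a < n" "b < n" by auto
    then have "(U * transpose_mat U) $$ (a, b) = (\<Sum>p = 0..<n. u a (f p) * u b (f p))"
      by (simp add: U_def scalar_prod_def)
    also have "\<dots> = (\<Sum>i\<in>V. u a i * u b i)"
      by (rule sum.reindex_bij_betw[OF f])
    finally show "(U * transpose_mat U) $$ (a, b) = 1\<^sub>m n $$ (a, b)"
      using on ab by (simp add: n_def)
  qed (use U in auto)
  then have inv: "transpose_mat U * U = 1\<^sub>m n"
    by (rule mat_mult_left_right_inverse[OF U transpose_carrier_mat[THEN iffD2, OF U]])
  obtain p q where pq: "p < n" "q < n" "i = f p" "j = f q"
    using f assms(3,4) by (auto simp: bij_betw_def)
  have "(\<Sum>a<n. u a i * u a j) = (transpose_mat U * U) $$ (p, q)"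
    using pq by (simp add: U_def scalar_prod_def lessThan_atLeast0)
  also have "\<dots> = (if i = j then 1 else 0)"
    using inv pq f by (auto simp: bij_betw_def inj_on_def)
  finally show ?thesis by (simp add: n_def)
qed

lemma admissibleE:
  assumes "admissible V M u"
  obtains lam where
    "\<And>a b. a < card V \<Longrightarrow> b < card V \<Longrightarrow> (\<Sum>i\<in>V. u a i * u b i) = (if a = b then 1 else 0)"
    "\<And>a i. a < card V \<Longrightarrow> i \<in> V \<Longrightarrow> (\<Sum>j\<in>V. M i j * u a j) = lam a * u a i"
    "\<And>a b. a \<le> b \<Longrightarrow> b < card V \<Longrightarrow> lam b \<le> lam a"
proof -
  note adm = assms[unfolded admissible_def]
  from adm[THEN conjunct2] obtain lam where lam:
    "(\<forall>a < card V. \<forall>i\<in>V. (\<Sum>j\<in>V. M i j * u a j) = lam a * u a i) \<and>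
     (\<forall>a b. a \<le> b \<and> b < card V \<longrightarrow> lam b \<le> lam a)"
    by (rule exE)
  show thesis
    by (rule that[OF adm[THEN conjunct1, rule_format] lam[THEN conjunct1, rule_format]
          lam[THEN conjunct2, rule_format, OF conjI]])
qed

text \<open>
  Some eigenvector is not orthogonal to the constant vector, hence has eigenvalue \<open>r\<close>, so the top
  eigenvalue is at least \<open>r\<close>. As \<open>\<Sum> M i j (x i - x j)\<^sup>2\<close> equals \<open>2 (r \<parallel>x\<parallel>\<^sup>2 - x\<^sup>T M x)\<close>, it cannot
  be positive for a top eigenvector \<open>x\<close>.
\<close>

lemma top_eigenvector_const_on_support:
  fixes M :: "'a \<Rightarrow> 'a \<Rightarrow> real"
  assumes fin: "finite V"
    and adm: "admissible V M u"
    and sym: "\<And>i j. i \<in> V \<Longrightarrow> j \<in> V \<Longrightarrow> M i j = M j i"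
    and nonneg: "\<And>i j. i \<in> V \<Longrightarrow> j \<in> V \<Longrightarrow> 0 \<le> M i j"
    and row: "\<And>i. i \<in> V \<Longrightarrow> (\<Sum>j\<in>V. M i j) = r"
    and ij: "i \<in> V" "j \<in> V" "M i j \<noteq> 0"
  shows "u 0 i = u 0 j"
  using adm
proof (rule admissibleE)
  fix lam :: "nat \<Rightarrow> real"
  assume
    on: "\<And>a b. a < card V \<Longrightarrow> b < card V \<Longrightarrow> (\<Sum>i\<in>V. u a i * u b i) = (if a = b then 1 else 0)"
    and eig: "\<And>a i. a < card V \<Longrightarrow> i \<in> V \<Longrightarrow> (\<Sum>j\<in>V. M i j * u a j) = lam a * u a i"
    and mono: "\<And>a b. a \<le> b \<Longrightarrow> b < card V \<Longrightarrow> lam b \<le> lam a"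
  have n: "0 < card V" using fin ij by (auto simp: card_gt_0_iff)
  have "\<exists>a < card V. (\<Sum>i\<in>V. u a i) \<noteq> 0"
  proof (rule ccontr)
    assume "\<not> ?thesis"
    then have z: "(\<Sum>j\<in>V. u a j) = 0" if "a < card V" for a using that by blast
    \<comment> \<open>Row \<open>i\<close> of the completeness relation is summed over
      \<open>j\<close>. Its other side is a combination of the sums of the \<open>u a\<close>, all
      of which are assumed to vanish.\<close>
    have "1 = (\<Sum>j\<in>V. if i = j then 1 else 0 :: real)"
      using fin ij by simp
    also have "\<dots> = (\<Sum>j\<in>V. \<Sum>a<card V. u a i * u a j)"
      using orthonormal_family_complete[OF fin on ij(1)] by (intro sum.cong) auto
    also have "\<dots> = (\<Sum>a<card V. u a i * (\<Sum>j\<in>V. u a j))"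
      by (subst sum.swap) (simp add: sum_distrib_left)
    also have "\<dots> = 0" by (simp add: z)
    finally show False by simp
  qed
  then obtain a where a: "a < card V" "(\<Sum>i\<in>V. u a i) \<noteq> 0" by blast
  \<comment> \<open>The eigenvalue equation is paired with the constant vector; by symmetry the
    column sums of \<open>M\<close> are row sums, hence equal to \<open>r\<close>.\<close>
  have "lam a * (\<Sum>i\<in>V. u a i) = (\<Sum>i\<in>V. \<Sum>j\<in>V. M i j * u a j)"
    by (simp add: sum_distrib_left eig a)
  also have "\<dots> = (\<Sum>j\<in>V. (\<Sum>i\<in>V. M j i) * u a j)"
    by (subst sum.swap) (auto simp: sum_distrib_right sym intro!: sum.cong)
  also have "\<dots> = r * (\<Sum>i\<in>V. u a i)"
    by (simp add: row sum_distrib_left)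
  finally have "lam a = r" using a by simp
  then have r: "r \<le> lam 0" using mono[of 0 a] a by simp
  let ?x = "u 0"
  have sq1: "(\<Sum>i\<in>V. \<Sum>j\<in>V. M i j * (?x i)\<^sup>2) = r * (\<Sum>i\<in>V. (?x i)\<^sup>2)"
    by (simp add: row sum_distrib_left flip: sum_distrib_right)
  have "(\<Sum>i\<in>V. \<Sum>j\<in>V. M i j * (?x j)\<^sup>2) = (\<Sum>j\<in>V. \<Sum>i\<in>V. M j i * (?x j)\<^sup>2)"
    by (subst sum.swap) (auto simp: sym intro!: sum.cong)
  then have sq2: "(\<Sum>i\<in>V. \<Sum>j\<in>V. M i j * (?x j)\<^sup>2) = r * (\<Sum>i\<in>V. (?x i)\<^sup>2)"
    using sq1 by simp
  have "(\<Sum>i\<in>V. \<Sum>j\<in>V. M i j * (?x i * ?x j)) = (\<Sum>i\<in>V. ?x i * (\<Sum>j\<in>V. M i j * ?x j))"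
    by (simp add: sum_distrib_left mult_ac)
  also have "\<dots> = lam 0 * (\<Sum>i\<in>V. (?x i)\<^sup>2)"
    by (simp add: eig n sum_distrib_left power2_eq_square mult_ac)
  finally have cross: "(\<Sum>i\<in>V. \<Sum>j\<in>V. M i j * (?x i * ?x j)) = lam 0 * (\<Sum>i\<in>V. (?x i)\<^sup>2)" .
  have "(\<Sum>i\<in>V. \<Sum>j\<in>V. M i j * (?x i - ?x j)\<^sup>2) =
      (\<Sum>i\<in>V. \<Sum>j\<in>V. M i j * (?x i)\<^sup>2 + M i j * (?x j)\<^sup>2 - 2 * (M i j * (?x i * ?x j)))"
    by (intro sum.cong refl) (simp add: power2_eq_square algebra_simps)
  also have "\<dots> = 2 * ((r - lam 0) * (\<Sum>i\<in>V. (?x i)\<^sup>2))"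
    by (simp only: sum.distrib sum_subtractf sum_distrib_left[symmetric] sq1 sq2 cross)
      (simp add: algebra_simps)
  also have "\<dots> \<le> 0"
    using r by (simp add: mult_le_0_iff sum_nonneg)
  finally have le: "(\<Sum>i\<in>V. \<Sum>j\<in>V. M i j * (?x i - ?x j)\<^sup>2) \<le> 0" .
  \<comment> \<open>All summands are nonnegative, so the single term at \<open>(i, j)\<close> is
    bounded by the whole double sum.\<close>
  have "M i j * (?x i - ?x j)\<^sup>2 \<le> (\<Sum>j\<in>V. M i j * (?x i - ?x j)\<^sup>2)"
    using fin ij nonneg by (intro member_le_sum) auto
  also have "\<dots> \<le> (\<Sum>i\<in>V. \<Sum>j\<in>V. M i j * (?x i - ?x j)\<^sup>2)"
    using fin ij nonneg by (intro member_le_sum[of i V "\<lambda>i. \<Sum>j\<in>V. M i j * (?x i - ?x j)\<^sup>2"]) (auto intro!: sum_nonneg)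
  finally have "M i j * (?x i - ?x j)\<^sup>2 \<le> 0" using le by simp
  then have "(?x i - ?x j)\<^sup>2 = 0"
    using nonneg[OF ij(1,2)] ij(3) by (simp add: mult_le_0_iff)
  then show ?thesis by simp
qed

text \<open>On a constant vector \<open>M\<close> acts by multiplying the entry at \<open>i\<close>
  with the row sum at \<open>i\<close>; the eigenvalue equation then makes every row sum equal to
  \<open>lam 0\<close>, once \<open>c\<close> can be cancelled.\<close>

lemma const_eigenvector_imp_row_sums_eq:
  assumes "finite V" "admissible V M u"
    and const: "\<And>i. i \<in> V \<Longrightarrow> u 0 i = c" and ij: "i \<in> V" "j \<in> V"
  shows "(\<Sum>l\<in>V. M i l) = (\<Sum>l\<in>V. M j l)"
  using assms(2)
proof (rule admissibleE)
  fix lam :: "nat \<Rightarrow> real"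
  assume
    orth: "\<And>a b. a < card V \<Longrightarrow> b < card V \<Longrightarrow> (\<Sum>i\<in>V. u a i * u b i) = (if a = b then 1 else 0)"
    and eig: "\<And>a i. a < card V \<Longrightarrow> i \<in> V \<Longrightarrow> (\<Sum>j\<in>V. M i j * u a j) = lam a * u a i"
  have n: "0 < card V" using assms by (auto simp: card_gt_0_iff)
  have on: "(\<Sum>i\<in>V. u 0 i * u 0 i) = 1"
    using orth[OF n n] by simp
  \<comment> \<open>A zero vector would contradict the normalisation.\<close>
  have "c \<noteq> 0" using on const by auto
  moreover have "(\<Sum>j\<in>V. M i j) * c = lam 0 * c" if "i \<in> V" for i
    using eig[OF n that] const that by (simp add: sum_distrib_right)
  ultimately show ?thesis using ij by simp
qed

section \<open>The first coordinate of H-k-LAPE\<close>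

text \<open>As \<open>k\<close> is positive and \<open>V\<close> is nonempty, the first entry is a
  genuine eigenvector entry and not the default 0.\<close>

lemma hd_node_encoding:
  assumes "1 \<le> k" "finite V" "i \<in> V"
  shows "hd (node_encoding k V u i) = u 0 i"
  using assms by (auto simp: node_encoding_def hd_map upt_rec card_gt_0_iff)

text \<open>The two ends of an arc form a clique, which extends to a maximal one. That hyperedge
  contributes 1 to a sum of nonnegative terms.\<close>

lemma hodge_laplacian_arc_pos:
  assumes "pair_graph G" "(u, v) \<in> parcs G"
  shows "0 < hodge_laplacian G u v"
proof -
  interpret pair_graph G by fact
  let ?S = "{C. is_clique G C}"
  have fin: "finite ?S"
    by (rule finite_subset[of _ "Pow (pverts G)"]) (auto simp: is_clique_def)
  have "u \<noteq> v" using no_loops[of "(u, v)"] assms by auto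
  have "(v, u) \<in> parcs G" using assms(2) by (rule arcs_symmetric)
  with assms(2) have "{u, v} \<in> ?S"
    using wellformed[of "(u, v)"] by (auto simp: is_clique_def)
  from finite_has_maximal2[OF fin this] obtain C where
    C: "is_clique G C" "{u, v} \<subseteq> C" "\<forall>D. is_clique G D \<longrightarrow> C \<subseteq> D \<longrightarrow> C = D"
    by auto
  have "finite C" using C(1) finite_subset[OF _ finite_verts] by (auto simp: is_clique_def)
  then have "2 \<le> card C" using card_mono[OF _ C(2)] \<open>u \<noteq> v\<close> by simp
  then have "C \<in> hyperedges G" using C by (auto simp: hyperedges_def maximal_clique_def)
  moreover have "finite (hyperedges G)"
    by (rule finite_subset[OF _ fin]) (auto simp: hyperedges_def maximal_clique_def)
  ultimately show ?thesis
    unfolding hodge_laplacian_def using C(2)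
    by (intro sum_pos2[of _ C]) (auto simp: incidence_matrix_def)
qed

lemma distinguished_by_HLAPE_I:
  fixes G :: "'a pair_pre_digraph" and G' :: "'b pair_pre_digraph"
  assumes G: "pair_graph G"
    and row: "\<And>i. i \<in> pverts G \<Longrightarrow> (\<Sum>j\<in>pverts G. hodge_laplacian G i j) = r"
    and conn: "\<And>i. i \<in> pverts G \<Longrightarrow> (i0, i) \<in> (parcs G)\<^sup>*"
    and G': "pair_graph G'" "p \<in> pverts G'" "q \<in> pverts G'"
      "(\<Sum>j\<in>pverts G'. hodge_laplacian G' p j) \<noteq> (\<Sum>j\<in>pverts G'. hodge_laplacian G' q j)"
    and "1 \<le> k"
  shows "distinguished_by_HLAPE k G G'"
  unfolding distinguished_by_HLAPE_def
proof (intro allI impI notI)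
  interpret G: pair_graph G by fact
  interpret G': pair_graph G' by fact
  fix u :: "nat \<Rightarrow> 'a \<Rightarrow> real" and u' :: "nat \<Rightarrow> 'b \<Rightarrow> real"
  assume adm: "admissible (pverts G) (hodge_laplacian G) u"
    and adm': "admissible (pverts G') (hodge_laplacian G') u'"
    and eq: "node_multiset G (node_encoding k (pverts G) u) =
      node_multiset G' (node_encoding k (pverts G') u')"
  \<comment> \<open>Multiplicities and all later coordinates are forgotten: only the sets of first
    coordinates are compared.\<close>
  from arg_cong[OF eq, of "\<lambda>m. hd ` set_mset m"]
  have im: "u 0 ` pverts G = u' 0 ` pverts G'"
    by (simp add: node_multiset_def image_image hd_node_encoding[OF \<open>1 \<le> k\<close>] cong: image_cong_simp)
  have step: "u 0 i = u 0 j" if "(i, j) \<in> parcs G" for i j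
  proof (rule top_eigenvector_const_on_support[OF G.finite_verts adm _ _ row])
    show "hodge_laplacian G i j \<noteq> 0" using hodge_laplacian_arc_pos[OF G that] by simp
    show "i \<in> pverts G" "j \<in> pverts G" using G.wellformed[OF that] by simp_all
  qed (auto simp: hodge_laplacian_def incidence_matrix_def mult.commute intro!: sum_nonneg)
  have const: "u 0 i = u 0 i0" if "i \<in> pverts G" for i
    using conn[OF that] by (induction rule: rtrancl_induct) (auto dest: step)
  \<comment> \<open>The set of values is a singleton for \<open>G\<close>, hence also for
    \<open>G'\<close>, so \<open>u' 0\<close> is a constant eigenvector.\<close>
  have "u' 0 q' = u 0 i0" if "q' \<in> pverts G'" for q'
    using im that const by (metis imageE imageI)
  from const_eigenvector_imp_row_sums_eq[OF G'.finite_verts adm' this G'(2,3)] G'(4)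
  show False by simp
qed

section \<open>The example graphs: hyperedges, row sums and common eigenvectors\<close>

text \<open>By \<open>closed\<close>, a clique sharing two vertices with some \<open>e\<close> in
  \<open>E\<close> lies inside \<open>e\<close>. This reduces maximality to conditions on vertices,
  which the simplifier can check on an explicit graph without enumerating vertex sets.\<close>

lemma hyperedges_eqI:
  assumes clique: "\<forall>e\<in>E. is_clique G e \<and> 2 \<le> card e"
    and cover: "\<forall>(u, v)\<in>parcs G. \<exists>e\<in>E. u \<in> e \<and> v \<in> e"
    and closed: "\<forall>e\<in>E. \<forall>u\<in>e. \<forall>v\<in>e. u \<noteq> v \<longrightarrow>
      (\<forall>w\<in>pverts G. (u, w) \<in> parcs G \<longrightarrow> (v, w) \<in> parcs G \<longrightarrow> w \<in> e)"
  shows "hyperedges G = E"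
proof -
  have sub: "C \<subseteq> e" if "is_clique G C" "e \<in> E" "u \<in> e" "v \<in> e" "u \<noteq> v" "u \<in> C" "v \<in> C" for C e u v
  proof
    fix w assume "w \<in> C"
    then show "w \<in> e"
    proof (cases "w = u \<or> w = v")
      case False
      with that(1,6,7) \<open>w \<in> C\<close> have "(u, w) \<in> parcs G" "(v, w) \<in> parcs G" "w \<in> pverts G"
        by (auto simp: is_clique_def)
      with that(2-5) show ?thesis by (intro closed[rule_format, of e u v w])
    qed (use that(3,4) in auto)
  qed
  \<comment> \<open>Infinite sets have \<open>card\<close> 0, so the bound also implies
    finiteness.\<close>
  have two: "\<exists>u v. u \<in> C \<and> v \<in> C \<and> u \<noteq> v" if "2 \<le> card C" for C :: "'a set"
    using that by (metis One_nat_def card_le_Suc0_iff_eq card.infinite not_less_eq_eq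
        numeral_2_eq_2 zero_le)
  show ?thesis
  proof (intro equalityI subsetI)
    fix C assume "C \<in> hyperedges G"
    then have C: "is_clique G C" "2 \<le> card C" "\<And>C'. is_clique G C' \<Longrightarrow> C \<subseteq> C' \<Longrightarrow> C' = C"
      by (auto simp: hyperedges_def maximal_clique_def)
    then obtain u v where uv: "u \<in> C" "v \<in> C" "u \<noteq> v" using two by blast
    then have "(u, v) \<in> parcs G" using C by (auto simp: is_clique_def)
    then obtain e where e: "e \<in> E" "u \<in> e" "v \<in> e" using cover by blast
    then have "C \<subseteq> e" using sub C uv by blast
    then show "C \<in> E" using C(3)[of e] clique e by auto
  next
    fix e assume e: "e \<in> E"
    then obtain u v where uv: "u \<in> e" "v \<in> e" "u \<noteq> v" using two clique by blast
    have "C' = e" if "is_clique G C'" "e \<subseteq> C'" for C'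
      using sub[OF that(1) e uv] uv that(2) by blast
    then show "e \<in> hyperedges G"
      using clique e by (simp add: hyperedges_def maximal_clique_def)
  qed
qed

definition undirected :: "'a set \<Rightarrow> ('a \<times> 'a) set \<Rightarrow> 'a pair_pre_digraph" where
  "undirected V E = \<lparr>pverts = V, parcs = E \<union> prod.swap ` E\<rparr>"

lemma pair_graph_undirected:
  assumes "finite V" "E \<subseteq> V \<times> V" "irrefl E"
  shows "pair_graph (undirected V E)"
proof
  show "finite (parcs (undirected V E))"
    using assms finite_subset[of E "V \<times> V"] by (auto simp: undirected_def)
  show "fst e \<noteq> snd e" if "e \<in> parcs (undirected V E)" for e
    using that assms by (auto simp: undirected_def irrefl_def)
  show "symmetric (with_proj (undirected V E))"
    unfolding symmetric_def with_proj_simps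
    by (rule symI) (auto simp: undirected_def)
qed (use assms in \<open>auto simp: undirected_def\<close>)

text \<open>A sum over an explicit vertex set can be evaluated by simplification.\<close>

lemma card_neighbours:
  assumes "finite (pverts G)"
  shows "card (neighbours G v) = (\<Sum>u\<in>pverts G. if (v, u) \<in> parcs G then 1 else 0)"
  using assms by (simp add: neighbours_def sum.If_cases Int_def)

definition C7 :: "nat pair_pre_digraph" where
  "C7 = undirected {0,1,2,3,4,5,6} {(0,1),(1,2),(2,3),(3,4),(4,5),(5,6),(6,0)}"

definition C3_C4 :: "nat pair_pre_digraph" where
  "C3_C4 = undirected {0,1,2,3,4,5,6} {(0,1),(1,2),(2,0),(3,4),(4,5),(5,6),(6,3)}"

definition K3 :: "nat pair_pre_digraph" where
  "K3 = undirected {0,1,2} {(0,1),(1,2),(2,0)}"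

definition P3 :: "nat pair_pre_digraph" where
  "P3 = undirected {0,1,2} {(0,1),(1,2)}"

lemma pair_graphs: "pair_graph C7" "pair_graph C3_C4" "pair_graph K3" "pair_graph P3"
  unfolding C7_def C3_C4_def K3_def P3_def
  by (rule pair_graph_undirected; auto simp: irrefl_def)+

lemma hyperedges_C7: "hyperedges C7 = {{0,1},{1,2},{2,3},{3,4},{4,5},{5,6},{6,0}}"
  by (rule hyperedges_eqI) (simp_all add: C7_def undirected_def is_clique_def)

lemma hyperedges_C3_C4: "hyperedges C3_C4 = {{0,1,2},{3,4},{4,5},{5,6},{6,3}}"
  by (rule hyperedges_eqI) (simp_all add: C3_C4_def undirected_def is_clique_def)

lemma hyperedges_K3: "hyperedges K3 = {{0,1,2}}"
  by (rule hyperedges_eqI) (simp_all add: K3_def undirected_def is_clique_def)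

lemma hyperedges_P3: "hyperedges P3 = {{0,1},{1,2}}"
  by (rule hyperedges_eqI) (simp_all add: P3_def undirected_def is_clique_def)

lemma regular_C7: "regular C7 2" and regular_C3_C4: "regular C3_C4 2"
  by (simp_all add: regular_def card_neighbours C7_def C3_C4_def undirected_def)

lemma distinguished_by_HLAPE_C7_C3_C4:
  assumes "1 \<le> k"
  shows "distinguished_by_HLAPE k C7 C3_C4"
proof (rule distinguished_by_HLAPE_I[OF pair_graphs(1) _ _ pair_graphs(2) _ _ _ assms])
  \<comment> \<open>The row sum at \<open>i\<close> is the total size of the hyperedges containing
    \<open>i\<close>: here two hyperedges of size 2.\<close>
  show "(\<Sum>j\<in>pverts C7. hodge_laplacian C7 i j) = 4" if "i \<in> pverts C7" for i
    using that unfolding hodge_laplacian_def hyperedges_C7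
    by (auto simp: C7_def undirected_def incidence_matrix_def doubleton_eq_iff)
  show "(0, i) \<in> (parcs C7)\<^sup>*" if "i \<in> pverts C7" for i
  proof -
    have arc: "(i, Suc i) \<in> parcs C7" if "i \<le> 5" for i
      using that by (auto simp: C7_def undirected_def numeral_eq_Suc le_Suc_eq)
    have "i \<le> 6 \<Longrightarrow> (0, i) \<in> (parcs C7)\<^sup>*"
      by (induction i) (auto intro: rtrancl_into_rtrancl arc)
    then show ?thesis using that by (auto simp: C7_def undirected_def)
  qed
  show "0 \<in> pverts C3_C4" "3 \<in> pverts C3_C4"
    by (simp_all add: C3_C4_def undirected_def)
  \<comment> \<open>Vertex 0 lies only in the triangle, giving 3; vertex 3 lies in two edges of the
    4-cycle, giving 4.\<close>
  show "(\<Sum>j\<in>pverts C3_C4. hodge_laplacian C3_C4 0 j)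
      \<noteq> (\<Sum>j\<in>pverts C3_C4. hodge_laplacian C3_C4 3 j)"
    unfolding hodge_laplacian_def hyperedges_C3_C4
    by (simp add: C3_C4_def undirected_def incidence_matrix_def set_eq_subset)
qed

lemma distinguished_by_HLAPE_K3_P3:
  assumes "1 \<le> k"
  shows "distinguished_by_HLAPE k K3 P3"
proof (rule distinguished_by_HLAPE_I[OF pair_graphs(3) _ _ pair_graphs(4) _ _ _ assms])
  show "(\<Sum>j\<in>pverts K3. hodge_laplacian K3 i j) = 3" if "i \<in> pverts K3" for i
    using that unfolding hodge_laplacian_def hyperedges_K3
    by (auto simp: K3_def undirected_def incidence_matrix_def)
  show "(0, i) \<in> (parcs K3)\<^sup>*" if "i \<in> pverts K3" for i
    using that by (auto simp: K3_def undirected_def)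
  show "0 \<in> pverts P3" "1 \<in> pverts P3"
    by (simp_all add: P3_def undirected_def)
  \<comment> \<open>The end 0 lies in one edge and the middle vertex 1 in two, giving 2 and
    4.\<close>
  show "(\<Sum>j\<in>pverts P3. hodge_laplacian P3 0 j) \<noteq> (\<Sum>j\<in>pverts P3. hodge_laplacian P3 1 j)"
    unfolding hodge_laplacian_def hyperedges_P3
    by (simp add: P3_def undirected_def incidence_matrix_def doubleton_eq_iff)
qed

text \<open>Simultaneous eigenvectors of the two graph Laplacians, with eigenvalues 3, 3, 0 for \<open>K3\<close> and
  3, 1, 0 for \<open>P3\<close>.\<close>

definition common_eigenvectors :: "nat \<Rightarrow> nat \<Rightarrow> real" where
  "common_eigenvectors a i =
     (if a = 0 then (if i = 1 then - 2 else 1) / sqrt 6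
      else if a = 1 then (if i = 0 then 1 else if i = 1 then 0 else - 1) / sqrt 2
      else 1 / sqrt 3)"

lemma admissible_common_eigenvectors:
  "admissible (pverts K3) (graph_laplacian K3) common_eigenvectors"
  "admissible (pverts P3) (graph_laplacian P3) common_eigenvectors"
proof -
  have less_3: "a < 3 \<longleftrightarrow> a = 0 \<or> a = 1 \<or> a = 2" for a :: nat by auto
  show "admissible (pverts K3) (graph_laplacian K3) common_eigenvectors"
    unfolding admissible_def
  proof (intro conjI exI[of _ "\<lambda>a. if a \<le> 1 then 3 else 0 :: real"])
  qed (auto simp: K3_def undirected_def common_eigenvectors_def less_3 graph_laplacian_def
      degree_matrix_def adjacency_matrix_def card_neighbours)
  show "admissible (pverts P3) (graph_laplacian P3) common_eigenvectors"
    unfolding admissible_def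
  proof (intro conjI exI[of _ "\<lambda>a. if a = 0 then 3 else if a = 1 then 1 else 0 :: real"])
  qed (auto simp: P3_def undirected_def common_eigenvectors_def less_3 graph_laplacian_def
      degree_matrix_def adjacency_matrix_def card_neighbours)
qed

text \<open>Both graphs have the same vertex set, so one family of eigenvectors admissible for both
  yields identical encodings for every \<open>k\<close>.\<close>

lemma not_distinguished_by_LAPE_K3_P3: "\<not> distinguished_by_LAPE k K3 P3"
proof -
  have "pverts K3 = pverts P3" by (simp add: K3_def P3_def undirected_def)
  then show ?thesis
    using admissible_common_eigenvectors
    by (auto simp: distinguished_by_LAPE_def node_multiset_def)
qed

theorem theorem3p2:
  fixes k :: nat
  assumes "1 \<le> k"
  shows
    "(\<forall>(G :: 'a pair_pre_digraph) (G' :: 'b pair_pre_digraph). pair_graph G \<longrightarrow> pair_graph G' \<longrightarrow>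
        distinguished_by_WL G G' \<longrightarrow> distinguished_by_MPGNN_HLAPE k G G') \<and>
     (\<forall>(G :: 'a pair_pre_digraph) (G' :: 'b pair_pre_digraph). pair_graph G \<longrightarrow> pair_graph G' \<longrightarrow>
        distinguished_by_MPGNN G G' \<longrightarrow> distinguished_by_MPGNN_HLAPE k G G') \<and>
     (\<exists>(G :: nat pair_pre_digraph) (G' :: nat pair_pre_digraph). pair_graph G \<and> pair_graph G' \<and>
        \<not> distinguished_by_WL G G' \<and> distinguished_by_MPGNN_HLAPE k G G') \<and>
     (\<exists>(G :: nat pair_pre_digraph) (G' :: nat pair_pre_digraph). pair_graph G \<and> pair_graph G' \<and>
        \<not> distinguished_by_MPGNN G G' \<and> distinguished_by_MPGNN_HLAPE k G G') \<and>
     (\<exists>(G :: nat pair_pre_digraph) (G' :: nat pair_pre_digraph). pair_graph G \<and> pair_graph G' \<and>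
        distinguished_by_HLAPE k G G' \<and> \<not> distinguished_by_LAPE k G G')"
proof (intro conjI allI impI exI)
  show "distinguished_by_MPGNN_HLAPE k G G'"
    if "pair_graph G" "pair_graph G'" "distinguished_by_WL G G'"
    for G :: "'a pair_pre_digraph" and G' :: "'b pair_pre_digraph"
    using that by (intro distinguished_by_MPGNN_imp_HLAPE distinguished_by_WL_imp_MPGNN)
  show "distinguished_by_MPGNN_HLAPE k G G'" if "distinguished_by_MPGNN G G'"
    for G :: "'a pair_pre_digraph" and G' :: "'b pair_pre_digraph"
    using that by (rule distinguished_by_MPGNN_imp_HLAPE)
  show not_MPGNN: "\<not> distinguished_by_MPGNN C7 C3_C4"
    using regular_C7 regular_C3_C4
    by (rule not_distinguished_by_MPGNN_regular) (simp add: C7_def C3_C4_def undirected_def)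
  \<comment> \<open>By contraposition: networks simulate colour refinement, so whatever they cannot
    separate, the 1-WL test cannot either.\<close>
  then show "\<not> distinguished_by_WL C7 C3_C4"
    using distinguished_by_WL_imp_MPGNN pair_graphs(1,2) by blast
  show "distinguished_by_MPGNN_HLAPE k C7 C3_C4"
    using distinguished_by_HLAPE_C7_C3_C4[OF assms] by (rule distinguished_by_HLAPE_imp_MPGNN_HLAPE)
  then show "distinguished_by_MPGNN_HLAPE k C7 C3_C4" .
  show "distinguished_by_HLAPE k K3 P3"
    by (rule distinguished_by_HLAPE_K3_P3[OF assms])
qed (fact pair_graphs not_distinguished_by_LAPE_K3_P3)+

end
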